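(* Let $H$ be a Hilbert space and let $Y$ be any Banach space. Then the pair $(H,Y)$ has the Bishop-Phelps-Bollobás point property.
   Context: All spaces are over the same scalar field $\mathbb{K}$, which is $\mathbb{R}$ or $\mathbb{C}$. $S_X$ is the unit sphere of $X$, and $\mathcal{L}(X,Y)$ is the space of bounded linear operators from $X$ into $Y$. A pair $(X,Y)$ of Banach spaces has the Bishop-Phelps-Bollobás point property (BPBpp) if for every $\varepsilon>0$ there exists $\eta(\varepsilon)>0$ such that whenever $T\in\mathcal{L}(X,Y)$ with $\|T\|=1$ and $x\in S_X$ satisfy $\|T(x)\|>1-\eta(\varepsilon)$, there exists $S\in\mathcal{L}(X,Y)$ with $\|S\|=1$ such that $\|S(x)\|=1$ and $\|S-T\|<\varepsilon$. *)

theory Defs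
  imports "HOL-Analysis.Analysis"
begin

text \<open>
  The real case uses the library classes \<open>banach\<close> and \<open>real_inner\<close>. A complex normed space is a
  real normed space with a compatible complex scalar multiplication, so that completeness, bounded
  operators and the operator norm are those of the underlying real space.
\<close>

class complex_normed_vector = real_normed_vector +
  fixes scaleC :: "complex \<Rightarrow> 'a \<Rightarrow> 'a" (infixr "*\<^sub>C" 75)
  assumes scaleC_add_right: "c *\<^sub>C (x + y) = c *\<^sub>C x + c *\<^sub>C y"
    and scaleC_add_left: "(c + d) *\<^sub>C x = c *\<^sub>C x + d *\<^sub>C x"
    and scaleC_scaleC: "c *\<^sub>C (d *\<^sub>C x) = (c * d) *\<^sub>C x"
    and scaleC_of_real: "complex_of_real r *\<^sub>C x = r *\<^sub>R x"
    and norm_scaleC: "norm (c *\<^sub>C x) = cmod c * norm x"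

text \<open>
  The inner product is linear in the first argument. Axiom \<open>cinner_self\<close> says that it induces the
  norm, and hence also that it is positive definite.
\<close>

class complex_inner = complex_normed_vector +
  fixes cinner :: "'a \<Rightarrow> 'a \<Rightarrow> complex"
  assumes cinner_commute: "cinner x y = cnj (cinner y x)"
    and cinner_add_left: "cinner (x + y) z = cinner x z + cinner y z"
    and cinner_scaleC_left: "cinner (c *\<^sub>C x) y = c * cinner x y"
    and cinner_self: "cinner x x = complex_of_real ((norm x)\<^sup>2)"

instantiation complex :: complex_inner
begin

definition scaleC_complex :: "complex \<Rightarrow> complex \<Rightarrow> complex"
  where "scaleC_complex c x = c * x"

definition cinner_complex :: "complex \<Rightarrow> complex \<Rightarrow> complex"
  where "cinner_complex x y = x * cnj y"

instance
  by standard
    (simp_all add: scaleC_complex_def cinner_complex_def algebra_simps norm_mult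
      scaleR_conv_of_real complex_norm_square del: of_real_power)

end

text \<open>
  \<open>BPBpp_on L\<close> is the Bishop-Phelps-Bollobas point property with the operators \<open>T\<close> and \<open>S\<close>
  ranging over \<open>L\<close>, which is \<open>\<L>(X,Y)\<close>: all bounded real-linear operators in the real case, the
  complex-linear ones among them in the complex case. The norm on \<open>\<Rightarrow>\<^sub>L\<close> is the operator norm.
\<close>

definition BPBpp_on :: "('x::banach \<Rightarrow>\<^sub>L 'y::banach) set \<Rightarrow> bool"
  where "BPBpp_on L \<longleftrightarrow>
    (\<forall>\<epsilon>>0. \<exists>\<eta>>0. \<forall>T\<in>L. \<forall>x.
      norm T = 1 \<and> norm x = 1 \<and> norm (blinfun_apply T x) > 1 - \<eta> \<longrightarrow>
      (\<exists>S\<in>L. norm S = 1 \<and> norm (blinfun_apply S x) = 1 \<and> norm (S - T) < \<epsilon>))"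

definition real_BPBpp :: "'x::banach itself \<Rightarrow> 'y::banach itself \<Rightarrow> bool"
  where "real_BPBpp X Y \<longleftrightarrow> BPBpp_on (UNIV :: ('x \<Rightarrow>\<^sub>L 'y) set)"

definition complex_blinfuns ::
    "('x::complex_normed_vector \<Rightarrow>\<^sub>L 'y::complex_normed_vector) set"
  where "complex_blinfuns =
    {T. \<forall>c x. blinfun_apply T (c *\<^sub>C x) = c *\<^sub>C blinfun_apply T x}"

definition complex_BPBpp ::
    "'x::{complex_normed_vector, banach} itself \<Rightarrow> 'y::{complex_normed_vector, banach} itself \<Rightarrow> bool"
  where "complex_BPBpp X Y \<longleftrightarrow> BPBpp_on (complex_blinfuns :: ('x \<Rightarrow>\<^sub>L 'y) set)"

end

theory Submission imports Defs begin

text \<open>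
  The proof perturbs \<open>T\<close> repeatedly, keeping the unit vector \<open>x\<close> fixed, so that the norms at \<open>x\<close>
  tend to \<open>1\<close> while the perturbations have a small sum; the limit \<open>S\<close> then attains its norm at \<open>x\<close>.

  One perturbation goes as follows. Let \<open>P\<close> be the orthogonal projection onto the line through \<open>x\<close>
  and put \<open>G = T (I + \<epsilon> P)\<close>. Since \<open>T\<close> almost attains its norm at \<open>x\<close>, the norm of \<open>G\<close> is almost
  \<open>1 + \<epsilon>\<close>. On the other hand \<open>G u\<close> has norm at most \<open>1 + \<epsilon> \<parallel>P u\<parallel>\<close> for every unit vector \<open>u\<close>, so a
  point \<open>u\<close> at which \<open>G\<close> almost attains its norm has \<open>\<parallel>P u\<parallel>\<close> almost \<open>1\<close>: up to a scalar of modulus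
  \<open>1\<close>, it is close to \<open>x\<close>. How well \<open>G\<close> is normed at \<open>u\<close> can be prescribed independently of how
  well \<open>T\<close> was normed at \<open>x\<close>, which is the gain. A Hilbert space has a unitary \<open>U\<close> near the identity
  that takes \<open>x\<close> to (a multiple of) \<open>u\<close>; so \<open>G U\<close>, divided by its norm, is close to \<open>T\<close> and as well
  normed at the original point \<open>x\<close> as desired (lemma \<open>improve_at_point\<close>). Here \<open>U\<close> is a product of
  two reflections in lines (lemma \<open>rotation_exists\<close>). The iteration itself (lemma
  \<open>BPBpp_on_if_improvable\<close>) uses only that the set of operators is closed and that \<open>Y\<close> is complete.

  The argument needs no more from the scalars than an involution that fixes the reals, so
  it is carried out over a normed field, of which \<open>\<real>\<close> and \<open>\<complex>\<close> are the instances of interest.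
\<close>

section \<open>Iterating an improvement at a fixed point\<close>

text \<open>
  The tolerance \<open>\<delta>\<close> may depend only on \<open>e\<close>, whereas \<open>\<delta>'\<close> is free. So \<open>\<delta>'\<close> can be chosen as the
  tolerance that belongs to the next, much smaller \<open>e\<close>, and the steps can be made summable.
\<close>

lemma BPBpp_on_if_improvable:
  fixes L :: "('x::banach \<Rightarrow>\<^sub>L 'y::banach) set"
  assumes cl: "closed L"
    and improve: "\<And>e. e > 0 \<Longrightarrow> \<exists>\<delta>>0. \<forall>T\<in>L. \<forall>x. \<forall>\<delta>'>0.
      norm T = 1 \<and> norm x = 1 \<and> norm (blinfun_apply T x) > 1 - \<delta> \<longrightarrow>
      (\<exists>T'\<in>L. norm T' = 1 \<and> norm (blinfun_apply T' x) > 1 - \<delta>' \<and> norm (T' - T) < e)"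
  shows "BPBpp_on L"
  unfolding BPBpp_on_def
proof (intro allI impI)
  fix \<epsilon> :: real
  assume \<epsilon>: "\<epsilon> > 0"
  define good where "good e \<delta> \<longleftrightarrow> \<delta> > 0 \<and> (\<forall>T\<in>L. \<forall>x. \<forall>\<delta>'>0.
      norm T = 1 \<and> norm x = 1 \<and> norm (blinfun_apply T x) > 1 - \<delta> \<longrightarrow>
      (\<exists>T'\<in>L. norm T' = 1 \<and> norm (blinfun_apply T' x) > 1 - \<delta>' \<and> norm (T' - T) < e))"
    for e \<delta> :: real
  define d where "d e = (SOME \<delta>. good e \<delta>)" for e
  have good: "good e (d e)" if "e > 0" for e
    unfolding d_def by (rule someI_ex) (use improve[OF that] in \<open>simp add: good_def\<close>)
  then have d: "d e > 0" if "e > 0" for e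
    using that by (simp add: good_def)
  have d_improve: "\<exists>T'\<in>L. norm T' = 1 \<and> norm (blinfun_apply T' x) > 1 - \<delta>' \<and> norm (T' - T) < e"
    if "e > 0" "T \<in> L" "\<delta>' > 0" "norm T = 1" "norm x = 1" "norm (blinfun_apply T x) > 1 - d e"
    for e T x \<delta>'
    using good[OF that(1)] that(2-) by (simp add: good_def)
  define e where "e n = \<epsilon> / 4 * (1 / 2) ^ n" for n :: nat
  \<comment> \<open>The bound \<open>d (e n)\<close> makes the next step possible; the other one makes the norms at \<open>x\<close> tend to \<open>1\<close>.\<close>
  define \<eta> where "\<eta> n = min (d (e n)) (1 / real (Suc n))" for n
  have e: "e n > 0" for n
    using \<epsilon> by (simp add: e_def)
  have \<eta>: "\<eta> n > 0" for n
    using d[OF e] by (simp add: \<eta>_def)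
  have e_sums: "e sums (\<epsilon> / 2)"
    using sums_mult[OF geometric_sums[of "1/2 :: real"], of "\<epsilon> / 4"] by (simp add: e_def[abs_def])
  show "\<exists>\<eta>>0. \<forall>T\<in>L. \<forall>x. norm T = 1 \<and> norm x = 1 \<and> norm (blinfun_apply T x) > 1 - \<eta> \<longrightarrow>
      (\<exists>S\<in>L. norm S = 1 \<and> norm (blinfun_apply S x) = 1 \<and> norm (S - T) < \<epsilon>)"
  proof (intro exI conjI ballI allI impI)
    show "\<eta> 0 > 0" by (rule \<eta>)
  next
    fix T x
    assume T: "T \<in> L" and Tx: "norm T = 1 \<and> norm x = 1 \<and> norm (blinfun_apply T x) > 1 - \<eta> 0"
    \<comment> \<open>The last conjunct makes the sequence start at \<open>T\<close>, from which the limit is to be estimated.\<close>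
    let ?P = "\<lambda>n T'. T' \<in> L \<and> norm T' = 1 \<and> norm (blinfun_apply T' x) > 1 - \<eta> n \<and> (n = 0 \<longrightarrow> T' = T)"
    have "\<exists>f. \<forall>n. ?P n (f n) \<and> norm (f (Suc n) - f n) < e n"
    proof (rule dependent_nat_choice)
      show "\<exists>T'. ?P 0 T'" using T Tx by blast
    next
      fix T' n
      assume T': "?P n T'"
      then have "norm (blinfun_apply T' x) > 1 - d (e n)" by (auto simp: \<eta>_def)
      then show "\<exists>T''. ?P (Suc n) T'' \<and> norm (T'' - T') < e n"
        using d_improve[OF e _ \<eta>, of T' x n "Suc n"] T' Tx by (simp add: Bex_def)
    qed
    then obtain f where f: "\<And>n. f n \<in> L" "\<And>n. norm (f n) = 1" "\<And>n. norm (blinfun_apply (f n) x) > 1 - \<eta> n"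
      and f0: "f 0 = T" and f_step: "\<And>n. norm (f (Suc n) - f n) < e n"
      by blast
    let ?g = "\<lambda>n. f (Suc n) - f n"
    have summable_norm: "summable (\<lambda>n. norm (?g n))"
      by (rule summable_comparison_test[OF _ sums_summable[OF e_sums]]) (simp_all add: f_step less_imp_le)
    have "f \<longlonglongrightarrow> T + suminf ?g"
    proof -
      have "(\<lambda>n. T + (\<Sum>i<n. ?g i)) \<longlonglongrightarrow> T + suminf ?g"
        by (intro tendsto_intros summable_LIMSEQ summable_norm_cancel[OF summable_norm])
      then show ?thesis by (simp add: sum_lessThan_telescope f0)
    qed
    define S where "S = T + suminf ?g"
    have lim: "f \<longlonglongrightarrow> S" unfolding S_def by fact
    have "S \<in> L"
      using closed_sequentially[OF cl _ lim] f(1) by blast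
    moreover have "norm S = 1"
      using LIMSEQ_unique[OF tendsto_norm[OF lim]] f(2) by simp
    moreover have "norm (S x) = 1"
    proof (rule antisym)
      show "norm (S x) \<le> 1"
        using norm_blinfun[of S x] Tx \<open>norm S = 1\<close> by simp
      have "(\<lambda>n. norm (f n x)) \<longlonglongrightarrow> norm (S x)"
        by (intro tendsto_intros lim)
      moreover have "(\<lambda>n. 1 - 1 / real (Suc n)) \<longlonglongrightarrow> 1 - 0"
        by (intro tendsto_intros LIMSEQ_Suc lim_1_over_n)
      moreover have "1 - 1 / real (Suc n) \<le> norm (f n x)" for n
        using f(3)[of n] by (auto simp: \<eta>_def)
      ultimately have "1 - 0 \<le> norm (S x)"
        by (intro LIMSEQ_le) auto
      then show "1 \<le> norm (S x)" by simp
    qed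
    moreover have "norm (S - T) < \<epsilon>"
    proof -
      have "norm (S - T) \<le> (\<Sum>n. norm (?g n))"
        by (simp add: S_def summable_norm[THEN Series.summable_norm])
      also have "\<dots> \<le> suminf e"
        by (rule suminf_le[OF _ summable_norm sums_summable[OF e_sums]]) (simp_all add: f_step less_imp_le)
      also have "\<dots> < \<epsilon>"
        using sums_unique[OF e_sums] \<epsilon> by simp
      finally show ?thesis .
    qed
    ultimately show "\<exists>S\<in>L. norm S = 1 \<and> norm (blinfun_apply S x) = 1 \<and> norm (S - T) < \<epsilon>"
      by blast
  qed
qed

lemma blinfun_almost_attains_norm:
  fixes G :: "'x::real_normed_vector \<Rightarrow>\<^sub>L 'y::real_normed_vector"
  assumes "a < norm G" "0 \<le> a"
  obtains u where "norm u = 1" "a < norm (G u)"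
proof -
  obtain v where v: "a * norm v < norm (G v)"
    using norm_blinfun_bound[OF assms(2), of G] assms(1) by (meson not_le)
  then have "v \<noteq> 0" by (metis blinfun.zero_right mult_zero_right norm_zero less_irrefl)
  then have "norm (v /\<^sub>R norm v) = 1" by simp
  moreover have "a < norm (G (v /\<^sub>R norm v))"
    using v \<open>v \<noteq> 0\<close>
    by (simp add: blinfun.scaleR_right divide_inverse_commute[symmetric] pos_less_divide_eq)
  ultimately show ?thesis by (rule that)
qed

section \<open>Reflections and rotations\<close>

text \<open>
  An inner product space over a normed field \<open>'a\<close> with involution \<open>conj\<close>: for \<open>'a = real\<close> the
  involution is the identity, for \<open>'a = complex\<close> it is complex conjugation.
\<close>

locale inner_product_over =
  fixes scl :: "'a::real_normed_field \<Rightarrow> 'h::banach \<Rightarrow> 'h"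
    and ip :: "'h \<Rightarrow> 'h \<Rightarrow> 'a"
    and conj :: "'a \<Rightarrow> 'a"
  assumes scl_add_right: "scl c (x + y) = scl c x + scl c y"
    and scl_add_left: "scl (c + d) x = scl c x + scl d x"
    and scl_scl: "scl c (scl d x) = scl (c * d) x"
    and scl_of_real: "scl (of_real r) x = r *\<^sub>R x"
    and norm_scl: "norm (scl c x) = norm c * norm x"
    and conj_add: "conj (c + d) = conj c + conj d"
    and conj_mult: "conj (c * d) = conj c * conj d"
    and conj_of_real: "conj (of_real r) = of_real r"
    and ip_commute: "ip x y = conj (ip y x)"
    and ip_add_left: "ip (x + y) z = ip x z + ip y z"
    and ip_scl_left: "ip (scl c x) y = c * ip x y"
    and ip_self: "ip x x = of_real ((norm x)\<^sup>2)"
begin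

lemma conj_0: "conj 0 = 0" and conj_1: "conj 1 = 1"
  using conj_of_real[of 0] conj_of_real[of 1] by simp_all

lemma scl_scaleR: "scl c (r *\<^sub>R x) = r *\<^sub>R scl c x"
  by (metis scl_of_real scl_scl mult.commute)

lemma scl_uminus_right: "scl c (- x) = - scl c x"
  using scl_scaleR[of c "-1" x] by simp

lemma scl_diff_right: "scl c (x - y) = scl c x - scl c y"
  using scl_add_right[of c x "- y"] by (simp add: scl_uminus_right)

lemma ip_add_right: "ip x (y + z) = ip x y + ip x z"
  by (metis conj_add ip_add_left ip_commute)

lemma ip_scl_right: "ip x (scl c y) = conj c * ip x y"
  by (metis conj_mult ip_commute ip_scl_left)

lemma ip_scaleR_left: "ip (r *\<^sub>R x) y = of_real r * ip x y"
  by (metis ip_scl_left scl_of_real)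

lemma ip_scaleR_right: "ip x (r *\<^sub>R y) = of_real r * ip x y"
  by (metis ip_scl_right scl_of_real conj_of_real)

lemma ip_diff_left: "ip (x - y) z = ip x z - ip y z"
  using ip_add_left[of x "- y" z] ip_scaleR_left[of "-1" y z] by simp

lemma ip_diff_right: "ip z (x - y) = ip z x - ip z y"
  using ip_add_right[of z x "- y"] ip_scaleR_right[of z "-1" y] by simp

lemma norm_add_sq_orthogonal:
  assumes "ip x y = 0"
  shows "(norm (x + y))\<^sup>2 = (norm x)\<^sup>2 + (norm y)\<^sup>2"
proof -
  have "ip y x = 0" using assms ip_commute[of y x] conj_0 by simp
  then have "of_real ((norm (x + y))\<^sup>2) = (of_real ((norm x)\<^sup>2 + (norm y)\<^sup>2) :: 'a)"
    using assms ip_add_left[of x y "x + y"]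
    by (simp add: ip_add_right ip_self del: of_real_power)
  then show ?thesis by (simp only: of_real_eq_iff)
qed

definition line_proj :: "'h \<Rightarrow> 'h \<Rightarrow> 'h"
  where "line_proj w v = scl (ip v w) w"

lemma ip_line_proj:
  assumes "norm w = 1"
  shows "ip (line_proj w v) (v - line_proj w v) = 0"
proof -
  have "ip w w = 1" using ip_self[of w] assms by simp
  then show ?thesis
    by (simp add: line_proj_def ip_scl_left ip_diff_right ip_scl_right ip_commute[of w v])
qed

lemma norm_line_proj: "norm w = 1 \<Longrightarrow> norm (line_proj w v) = norm (ip v w)"
  by (simp add: line_proj_def norm_scl)

lemma norm_line_proj_sq:
  assumes "norm w = 1"
  shows "(norm v)\<^sup>2 = (norm (line_proj w v))\<^sup>2 + (norm (v - line_proj w v))\<^sup>2"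
  using norm_add_sq_orthogonal[OF ip_line_proj[OF assms, of v]]
  by (simp only: add_diff_eq add_diff_cancel_left')

lemma norm_line_proj_le: "norm w = 1 \<Longrightarrow> norm (line_proj w v) \<le> norm v"
  by (rule power2_le_imp_le) (use norm_line_proj_sq[of w v] in auto)

text \<open>The Cauchy-Schwarz inequality, because an orthogonal projection does not increase the norm.\<close>

lemma norm_ip_le: "norm (ip v y) \<le> norm v * norm y"
proof (cases "y = 0")
  case True
  then show ?thesis using ip_scaleR_right[of v 0 y] by simp
next
  case False
  define w where "w = y /\<^sub>R norm y"
  have w: "norm w = 1" "y = norm y *\<^sub>R w" using False by (simp_all add: w_def)
  have "norm (ip v y) = norm y * norm (ip v w)"
    by (subst w(2)) (simp add: ip_scaleR_right norm_mult)
  then show ?thesis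
    using mult_left_mono[OF norm_line_proj_le[OF w(1), of v], of "norm y"] norm_line_proj[OF w(1), of v]
    by (simp add: mult.commute)
qed

lemma line_proj_add: "line_proj w (u + v) = line_proj w u + line_proj w v"
  by (simp add: line_proj_def ip_add_left scl_add_left)

lemma line_proj_scl: "line_proj w (scl c v) = scl c (line_proj w v)"
  by (simp add: line_proj_def ip_scl_left scl_scl)

lemma line_proj_scaleR: "line_proj w (r *\<^sub>R v) = r *\<^sub>R line_proj w v"
  by (metis line_proj_scl scl_of_real)

lemma line_proj_self: "norm w = 1 \<Longrightarrow> line_proj w w = w"
  using scl_of_real[of 1 w] by (simp add: line_proj_def ip_self)

lemma line_proj_idem: "norm w = 1 \<Longrightarrow> line_proj w (line_proj w v) = line_proj w v"
  by (metis line_proj_def line_proj_scl line_proj_self)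

lemma bounded_linear_line_proj: "norm w = 1 \<Longrightarrow> bounded_linear (line_proj w)"
  by (rule bounded_linear_intro[where K = 1])
    (simp_all add: line_proj_add line_proj_scaleR norm_line_proj_le)

text \<open>The reflection that fixes the line through \<open>w\<close> and is \<open>- 1\<close> on its orthogonal complement.\<close>

definition reflect :: "'h \<Rightarrow> 'h \<Rightarrow> 'h"
  where "reflect w v = 2 *\<^sub>R line_proj w v - v"

lemma bounded_linear_reflect: "norm w = 1 \<Longrightarrow> bounded_linear (reflect w)"
  unfolding reflect_def[abs_def]
  by (intro bounded_linear_sub bounded_linear_ident bounded_linear_line_proj
      bounded_linear_const_scaleR)

lemma reflect_scl: "reflect w (scl c v) = scl c (reflect w v)"
  by (simp add: reflect_def line_proj_scl scl_diff_right scl_scaleR)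

lemma reflect_reflect: "norm w = 1 \<Longrightarrow> reflect w (reflect w v) = v"
  by (simp add: reflect_def line_proj_idem line_proj_scaleR line_proj_add
      linear_diff[OF bounded_linear.linear[OF bounded_linear_line_proj]] algebra_simps scaleR_2)

lemma norm_reflect:
  assumes "norm w = 1"
  shows "norm (reflect w v) = norm v"
proof -
  let ?p = "line_proj w v"
  have "ip ?p (- (v - ?p)) = 0"
    using ip_line_proj[OF assms, of v] by (simp add: ip_diff_right)
  from norm_add_sq_orthogonal[OF this]
  have "(norm (?p + - (v - ?p)))\<^sup>2 = (norm v)\<^sup>2"
    by (simp only: norm_minus_cancel norm_line_proj_sq[OF assms, of v])
  moreover have "reflect w v = ?p + - (v - ?p)"
    by (simp add: reflect_def scaleR_2)
  ultimately have "(norm (reflect w v))\<^sup>2 = (norm v)\<^sup>2" by (simp only:)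
  then show ?thesis by simp
qed

text \<open>
  Reflections depend continuously on the line: moving \<open>w\<close> changes both the coefficient and the
  direction of the projection onto its line, each by at most the distance moved.
\<close>

lemma norm_reflect_diff_le:
  assumes "norm w = 1" "norm x = 1"
  shows "norm (reflect w v - reflect x v) \<le> 4 * norm (w - x) * norm v"
proof -
  have "reflect w v - reflect x v = 2 *\<^sub>R (scl (ip v w) (w - x) + scl (ip v (w - x)) x)"
    using scl_add_left[of "ip v (w - x)" "ip v x" x]
    by (simp add: reflect_def line_proj_def scl_diff_right ip_diff_right algebra_simps)
  also have "norm \<dots> \<le> 2 * (norm (scl (ip v w) (w - x)) + norm (scl (ip v (w - x)) x))"
    using norm_triangle_ineq[of "scl (ip v w) (w - x)" "scl (ip v (w - x)) x"] by simp
  also have "\<dots> = 2 * (norm (ip v w) * norm (w - x) + norm (ip v (w - x)))"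
    using assms by (simp add: norm_scl)
  also have "\<dots> \<le> 2 * (norm v * norm (w - x) + norm v * norm (w - x))"
    using norm_ip_le[of v w] norm_ip_le[of v "w - x"] assms
    by (intro mult_left_mono add_mono mult_right_mono) auto
  finally show ?thesis by (simp add: algebra_simps)
qed

text \<open>
  If \<open>ip y x\<close> is real, the bisector of \<open>x\<close> and \<open>y\<close> defines a reflection that swaps them. Composed
  with the reflection in \<open>x\<close> itself it becomes a rotation from \<open>x\<close> to \<open>y\<close>, and it is near the
  identity when \<open>y\<close> is near \<open>x\<close>, since then the two reflections almost cancel.
\<close>

lemma rotation_exists:
  assumes x: "norm x = 1" and y: "norm y = 1" and r: "ip y x = of_real r" "r \<ge> 0"
  obtains U :: "'h \<Rightarrow>\<^sub>L 'h" where "\<And>c v. U (scl c v) = scl c (U v)" "\<And>v. norm (U v) = norm v"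
    "U x = y" "norm (U - id_blinfun) \<le> 4 * norm (y - x)"
proof -
  define s where "s = norm (x + y)"
  define w where "w = (x + y) /\<^sub>R s"
  have xy: "ip x y = of_real r" "ip x x = 1"
    using r ip_commute[of x y] conj_of_real ip_self[of x] x by simp_all
  have "of_real (s\<^sup>2) = (of_real (2 + 2 * r) :: 'a)"
    using ip_self[of "x + y"] ip_self[of x] ip_self[of y] x y xy r
    by (simp add: s_def ip_add_left ip_add_right add.commute)
  then have s2: "s\<^sup>2 = 2 + 2 * r" by (simp only: of_real_eq_iff)
  with r have "s \<noteq> 0" by auto
  then have s: "s > 0" by (simp add: s_def)
  then have w: "norm w = 1" by (simp add: w_def s_def)
  have ref_x: "reflect w x = y"
  proof -
    have "ip x w = of_real ((1 + r) / s)"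
      by (simp add: w_def ip_scaleR_right ip_add_right xy divide_inverse mult.commute)
    then have "line_proj w x = ((1 + r) / s) *\<^sub>R w"
      by (simp add: line_proj_def scl_of_real del: of_real_divide)
    also have "\<dots> = ((1 + r) / s\<^sup>2) *\<^sub>R (x + y)"
      by (simp add: w_def power2_eq_square divide_inverse)
    also have "(1 + r) / s\<^sup>2 = 1 / 2"
      using r by (simp add: s2 field_simps)
    finally show ?thesis by (simp add: reflect_def)
  qed
  \<comment> \<open>Pass through the midpoint \<open>m\<close> of \<open>x\<close> and \<open>y\<close>: each of \<open>m - x\<close> and \<open>w - m\<close> costs at most half.\<close>
  have wx: "norm (w - x) \<le> norm (y - x)"
  proof -
    define m where "m = (1/2) *\<^sub>R (x + y)"
    have "m - x = (1/2) *\<^sub>R (y - x)"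
      by (simp add: m_def algebra_simps flip: scaleR_add_left)
    then have mx: "norm (m - x) = norm (y - x) / 2" by simp
    have "w - m = (1 - s / 2) *\<^sub>R w"
      using s by (simp add: w_def m_def algebra_simps)
    then have "norm (w - m) = \<bar>1 - s / 2\<bar>" using w by simp
    also have "\<dots> = \<bar>norm x - norm m\<bar>" by (simp add: x m_def s_def)
    also have "\<dots> \<le> norm (m - x)" using norm_triangle_ineq3[of x m] by (simp add: norm_minus_commute)
    finally show ?thesis
      using mx norm_triangle_ineq[of "w - m" "m - x"] by simp
  qed
  define U where "U = Blinfun (\<lambda>v. reflect w (reflect x v))"
  have "bounded_linear (\<lambda>v. reflect w (reflect x v))"
    using bounded_linear_compose[OF bounded_linear_reflect[OF w] bounded_linear_reflect[OF x]] .
  then have U: "U v = reflect w (reflect x v)" for v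
    by (simp add: U_def bounded_linear_Blinfun_apply)
  show ?thesis
  proof (rule that)
    show "U (scl c v) = scl c (U v)" for c v by (simp add: U reflect_scl)
    show "norm (U v) = norm v" for v by (simp add: U norm_reflect w x)
    have "reflect x x = x" by (simp add: reflect_def line_proj_self x scaleR_2)
    then show "U x = y" by (simp add: U ref_x)
    show "norm (U - id_blinfun) \<le> 4 * norm (y - x)"
    proof (rule norm_blinfun_bound)
      fix v
      \<comment> \<open>\<open>U - I = (R\<^sub>w - R\<^sub>x) R\<^sub>x\<close> because the reflection \<open>R\<^sub>x\<close> is its own inverse.\<close>
      have "(U - id_blinfun) v = reflect w (reflect x v) - reflect x (reflect x v)"
        by (simp add: U blinfun.diff_left reflect_reflect x)
      also have "norm \<dots> \<le> 4 * norm (w - x) * norm (reflect x v)"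
        by (rule norm_reflect_diff_le[OF w x])
      also have "\<dots> \<le> 4 * norm (y - x) * norm v"
        using wx by (simp add: norm_reflect x mult_right_mono)
      finally show "norm ((U - id_blinfun) v) \<le> 4 * norm (y - x) * norm v" .
    qed simp
  qed
qed

text \<open>
  Only the line through \<open>u\<close> matters for where an operator almost attains its norm, and on that line
  there is a unit vector whose inner product with \<open>x\<close> is real and nonnegative.
\<close>

lemma rotation_to_line:
  assumes x: "norm x = 1" and u: "norm u = 1" and nz: "ip u x \<noteq> 0"
  obtains U :: "'h \<Rightarrow>\<^sub>L 'h" and c where "\<And>c v. U (scl c v) = scl c (U v)" "\<And>v. norm (U v) = norm v"
    "U x = scl c u" "norm c = 1" "norm (U - id_blinfun) \<le> 4 * sqrt (2 - 2 * norm (ip u x))"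
proof -
  define r where "r = norm (ip u x)"
  define c where "c = of_real r / ip u x"
  define y where "y = scl c u"
  have c: "norm c = 1" using nz by (simp add: c_def r_def norm_divide)
  have y: "norm y = 1" by (simp add: y_def norm_scl c u)
  have yx: "ip y x = of_real r" using nz by (simp add: y_def ip_scl_left c_def)
  then have xy: "ip x y = of_real r" using ip_commute[of x y] conj_of_real by simp
  have "of_real ((norm (y - x))\<^sup>2) = (of_real (2 - 2 * r) :: 'a)"
    using ip_self[of "y - x"] ip_self[of x] ip_self[of y] x y
    by (simp add: ip_diff_left ip_diff_right xy yx)
  then have "(norm (y - x))\<^sup>2 = 2 - 2 * r" by (simp only: of_real_eq_iff)
  then have "norm (y - x) = sqrt (2 - 2 * r)" by (metis norm_ge_zero real_sqrt_unique)
  with rotation_exists[OF x y yx] that[of _ c] c show ?thesis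
    by (metis norm_ge_zero r_def y_def)
qed

end

section \<open>Improving an operator at a point\<close>

text \<open>The target space only has to carry a compatible multiplication by the same scalars.\<close>

locale inner_product_operators = inner_product_over scl ip conj
  for scl :: "'a::real_normed_field \<Rightarrow> 'h::banach \<Rightarrow> 'h" and ip conj +
  fixes sclY :: "'a \<Rightarrow> 'y::banach \<Rightarrow> 'y"
  assumes sclY_add_right: "sclY c (y + z) = sclY c y + sclY c z"
    and sclY_scaleR: "sclY c (r *\<^sub>R y) = r *\<^sub>R sclY c y"
    and norm_sclY: "norm (sclY c y) = norm c * norm y"
begin

definition ops :: "('h \<Rightarrow>\<^sub>L 'y) set"
  where "ops = {T. \<forall>c x. blinfun_apply T (scl c x) = sclY c (blinfun_apply T x)}"

lemma closed_ops: "closed ops"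
proof -
  have bl: "bounded_linear (sclY c)" for c
    by (rule bounded_linear_intro[where K = "norm c"])
      (simp_all add: sclY_add_right sclY_scaleR norm_sclY)
  have "closed {T :: 'h \<Rightarrow>\<^sub>L 'y. T (scl c x) = sclY c (T x)}" for c x
    by (intro closed_Collect_eq continuous_intros bounded_linear.continuous_on[OF bl])
  moreover have "ops = (\<Inter>c. \<Inter>x. {T. blinfun_apply T (scl c x) = sclY c (blinfun_apply T x)})"
    by (auto simp: ops_def)
  ultimately show ?thesis by auto
qed

lemma ops_scaleR: "T \<in> ops \<Longrightarrow> r *\<^sub>R T \<in> ops"
  by (simp add: ops_def blinfun.scaleR_left sclY_scaleR)

lemma ops_compose:
  fixes A :: "'h \<Rightarrow>\<^sub>L 'h"
  shows "T \<in> ops \<Longrightarrow> (\<And>c v. A (scl c v) = scl c (A v)) \<Longrightarrow> T o\<^sub>L A \<in> ops"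
  by (simp add: ops_def)

text \<open>
  The bound \<open>e ^ 3 / 8\<close> on the defect of \<open>T\<close> at \<open>x\<close> forces the point \<open>u\<close> at which \<open>T (I + e P)\<close>
  almost attains its norm to satisfy \<open>\<parallel>P u\<parallel> > 1 - e\<^sup>2 / 2\<close>, that is, to have distance less than \<open>e\<close>
  from \<open>x\<close> after multiplication by a scalar of modulus \<open>1\<close>.
\<close>

lemma improve_at_point:
  assumes e: "0 < e" "e \<le> 1" and T: "T \<in> ops" "norm T = 1" and x: "norm x = 1"
    and Tx: "norm (blinfun_apply T x) > 1 - e ^ 3 / 8" and \<delta>': "\<delta>' > 0"
  shows "\<exists>T'\<in>ops. norm T' = 1 \<and> norm (blinfun_apply T' x) > 1 - \<delta>' \<and> norm (T' - T) \<le> 18 * e"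
proof -
  define \<delta> where "\<delta> = e ^ 3 / 8"
  have e3: "e ^ 3 \<le> 1" "e ^ 2 \<le> 1" using e by (simp_all add: power_le_one)
  have \<delta>: "0 < \<delta>" "\<delta> \<le> 1 / 8" using e e3 by (simp_all add: \<delta>_def)
  \<comment> \<open>The defect \<open>\<delta>'\<close> wanted for the new operator may be larger than \<open>\<delta>\<close>; the estimate of \<open>p\<close> below
    needs a defect of at most \<open>\<delta>\<close>.\<close>
  define \<theta> where "\<theta> = min \<delta> \<delta>'"
  have \<theta>: "0 < \<theta>" "\<theta> \<le> \<delta>" "\<theta> \<le> \<delta>'" "\<theta> < 1" using \<delta> \<delta>' by (auto simp: \<theta>_def)
  define A where "A = Blinfun (\<lambda>v. v + e *\<^sub>R line_proj x v)"
  have "bounded_linear (\<lambda>v. v + e *\<^sub>R line_proj x v)"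
    by (intro bounded_linear_add bounded_linear_ident bounded_linear_line_proj x
        bounded_linear_const_scaleR)
  then have A: "A v = v + e *\<^sub>R line_proj x v" for v
    by (simp add: A_def bounded_linear_Blinfun_apply)
  define G where "G = T o\<^sub>L A"
  have G: "G \<in> ops"
    unfolding G_def by (intro ops_compose T) (simp add: A scl_add_right line_proj_scl scl_scaleR)
  have G_le: "norm (G v) \<le> norm v + e * norm (line_proj x v)" for v
  proof -
    have "norm (G v) \<le> norm (A v)"
      using norm_blinfun[of T "A v"] T by (simp add: G_def)
    also have "\<dots> \<le> norm v + norm (e *\<^sub>R line_proj x v)"
      unfolding A by (rule norm_triangle_ineq)
    finally show ?thesis using e by simp
  qed
  have "norm (G v) \<le> 2 * norm v" for v
  proof -
    have "e * norm (line_proj x v) \<le> 1 * norm v"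
      using e norm_line_proj_le[OF x, of v] by (intro mult_mono) auto
    then show ?thesis using G_le[of v] by simp
  qed
  then have norm_G_le: "norm G \<le> 2" by (intro norm_blinfun_bound) auto
  have "G x = (1 + e) *\<^sub>R T x"
    by (simp add: G_def A line_proj_self x blinfun.add_right blinfun.scaleR_right scaleR_add_left)
  then have "(1 + e) * norm (T x) \<le> norm G"
    using norm_blinfun[of G x] x e by simp
  moreover have "(1 + e) * (1 - \<delta>) < (1 + e) * norm (T x)"
    using e Tx unfolding \<delta>_def by (intro mult_strict_left_mono) auto
  ultimately have G_ge: "(1 + e) * (1 - \<delta>) < norm G" by (rule less_le_trans[rotated])
  moreover have "0 \<le> (1 + e) * (1 - \<delta>)" using e \<delta> by simp
  ultimately have "0 < norm G" by (rule le_less_trans[rotated])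
  then have "(1 - \<theta>) * norm G < norm G" "0 \<le> (1 - \<theta>) * norm G"
    using \<theta> by simp_all
  then obtain u where u: "norm u = 1" "(1 - \<theta>) * norm G < norm (G u)"
    by (rule blinfun_almost_attains_norm)
  define p where "p = norm (ip u x)"
  have p: "1 - e\<^sup>2 / 2 < p"
  proof -
    have "(1 - \<delta>) * ((1 + e) * (1 - \<delta>)) < (1 - \<delta>) * norm G"
      using G_ge \<delta> by (intro mult_strict_left_mono) auto
    also have "\<dots> \<le> (1 - \<theta>) * norm G"
      using \<theta> by (intro mult_right_mono) auto
    also have "\<dots> < 1 + e * p"
      using u G_le[of u] by (simp add: p_def norm_line_proj x)
    finally have "(1 - \<delta>) * ((1 + e) * (1 - \<delta>)) < 1 + e * p" .
    moreover have "1 + e - 4 * \<delta> \<le> (1 - \<delta>) * ((1 + e) * (1 - \<delta>))"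
    proof -
      have "(1 - \<delta>) * ((1 + e) * (1 - \<delta>)) - (1 + e - 4 * \<delta>) = 2 * \<delta> * (1 - e) + (1 + e) * \<delta>\<^sup>2"
        by (simp add: algebra_simps power2_eq_square)
      moreover have "\<dots> \<ge> 0" using e \<delta> by (intro add_nonneg_nonneg mult_nonneg_nonneg) auto
      ultimately show ?thesis by linarith
    qed
    ultimately have "e - 4 * \<delta> < e * p" by linarith
    moreover have "e - 4 * \<delta> = e * (1 - e\<^sup>2 / 2)"
      by (simp add: \<delta>_def power2_eq_square power3_eq_cube algebra_simps)
    ultimately show ?thesis using e by simp
  qed
  then have "ip u x \<noteq> 0" using e3 by (auto simp: p_def)
  then obtain U :: "'h \<Rightarrow>\<^sub>L 'h" and c where U: "\<And>c v. U (scl c v) = scl c (U v)"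
    "\<And>v. norm (U v) = norm v" "U x = scl c u" "norm c = 1" and "norm (U - id_blinfun) \<le> 4 * sqrt (2 - 2 * p)"
    using rotation_to_line[OF x u(1)] unfolding p_def by metis
  moreover have "sqrt (2 - 2 * p) \<le> e"
    using p e by (intro real_le_lsqrt) auto
  ultimately have U_near: "norm (U - id_blinfun) \<le> 4 * e" by linarith
  define G' where "G' = G o\<^sub>L U"
  have G': "G' \<in> ops" unfolding G'_def by (intro ops_compose G U)
  have G'x: "norm (G' x) = norm (G u)"
    using G by (simp add: G'_def U ops_def norm_sclY)
  have G'_le: "norm G' \<le> norm G"
    unfolding G'_def
  proof (rule norm_blinfun_bound)
    show "norm ((G o\<^sub>L U) v) \<le> norm G * norm v" for v
      using norm_blinfun[of G "U v"] by (simp add: U(2))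
  qed simp
  have "0 < norm (G' x)" using u \<open>0 \<le> (1 - \<theta>) * norm G\<close> unfolding G'x by linarith
  then have G'_pos: "0 < norm G'" using norm_blinfun[of G' x] unfolding x by linarith
  have "norm (G' - T) \<le> 9 * e"
  proof -
    have "G' - G = G o\<^sub>L (U - id_blinfun)"
      by (rule blinfun_eqI) (simp add: G'_def blinfun.diff_left blinfun.diff_right)
    then have "norm (G' - G) \<le> norm G * norm (U - id_blinfun)"
      by (simp add: norm_blinfun_compose)
    also have "\<dots> \<le> 2 * (4 * e)"
      using norm_G_le U_near by (intro mult_mono) auto
    finally have "norm (G' - G) \<le> 8 * e" by simp
    moreover have "norm (G - T) \<le> e"
    proof (rule norm_blinfun_bound)
      fix v
      have "(G - T) v = e *\<^sub>R T (line_proj x v)"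
        by (simp add: G_def A blinfun.diff_left blinfun.add_right blinfun.scaleR_right)
      then have "norm ((G - T) v) = e * norm (T (line_proj x v))" using e by simp
      also have "\<dots> \<le> e * norm v"
        using norm_blinfun[of T "line_proj x v"] T norm_line_proj_le[OF x, of v] e
        by (intro mult_left_mono) auto
      finally show "norm ((G - T) v) \<le> e * norm v" .
    qed (use e in simp)
    ultimately show ?thesis using norm_triangle_ineq[of "G' - G" "G - T"] by simp
  qed
  \<comment> \<open>As \<open>norm T = 1\<close>, dividing by \<open>norm G'\<close> at most doubles the distance \<open>9 * e\<close> from \<open>T\<close>.\<close>
  define T' where "T' = G' /\<^sub>R norm G'"
  have "T' \<in> ops" unfolding T'_def by (intro ops_scaleR G')
  moreover have "norm T' = 1" using G'_pos by (simp add: T'_def)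
  moreover have "norm (T' x) > 1 - \<delta>'"
  proof -
    have "(1 - \<delta>') * norm G' \<le> (1 - \<theta>) * norm G'"
      using \<theta> by (intro mult_right_mono) auto
    also have "\<dots> \<le> (1 - \<theta>) * norm G"
      using \<theta> G'_le by (intro mult_left_mono) auto
    also have "\<dots> < norm (G' x)" using u G'x by simp
    finally show ?thesis
      using G'_pos by (simp add: T'_def blinfun.scaleR_left field_simps)
  qed
  moreover have "norm (T' - T) \<le> 18 * e"
  proof -
    have "G' = norm G' *\<^sub>R T'"
      using G'_pos by (simp add: T'_def)
    then have "T' - G' = (1 - norm G') *\<^sub>R T'"
      by (simp add: scaleR_diff_left)
    then have "norm (T' - G') = \<bar>norm T - norm G'\<bar>"
      using \<open>norm T' = 1\<close> T by simp
    also have "\<dots> \<le> norm (G' - T)"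
      using norm_triangle_ineq3[of T G'] by (simp add: norm_minus_commute)
    finally show ?thesis
      using \<open>norm (G' - T) \<le> 9 * e\<close> norm_triangle_ineq[of "T' - G'" "G' - T"] by simp
  qed
  ultimately show ?thesis by blast
qed

lemma BPBpp_on_ops: "BPBpp_on ops"
proof (rule BPBpp_on_if_improvable[OF closed_ops])
  fix e' :: real
  assume e': "e' > 0"
  define e where "e = min 1 (e' / 19)"
  have e: "0 < e" "e \<le> 1" "18 * e < e'" using e' by (auto simp: e_def)
  show "\<exists>\<delta>>0. \<forall>T\<in>ops. \<forall>x. \<forall>\<delta>'>0.
      norm T = 1 \<and> norm x = 1 \<and> norm (blinfun_apply T x) > 1 - \<delta> \<longrightarrow>
      (\<exists>T'\<in>ops. norm T' = 1 \<and> norm (blinfun_apply T' x) > 1 - \<delta>' \<and> norm (T' - T) < e')"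
  proof (intro exI[of _ "e ^ 3 / 8"] conjI ballI allI impI; (elim conjE)?)
    show "0 < e ^ 3 / 8" using e by simp
  next
    fix T :: "'h \<Rightarrow>\<^sub>L 'y" and x and \<delta>' :: real
    assume "T \<in> ops" "\<delta>' > 0" "norm T = 1" "norm x = 1" "norm (T x) > 1 - e ^ 3 / 8"
    then obtain T' where "T' \<in> ops" "norm T' = 1" "norm (blinfun_apply T' x) > 1 - \<delta>'"
      "norm (T' - T) \<le> 18 * e"
      using improve_at_point[OF e(1,2)] by blast
    then show "\<exists>T'\<in>ops. norm T' = 1 \<and> norm (blinfun_apply T' x) > 1 - \<delta>' \<and> norm (T' - T) < e'"
      using e(3) by (meson le_less_trans)
  qed
qed

end

section \<open>Real and complex scalars\<close>

theorem theorem2p5: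
  "real_BPBpp TYPE('h::{real_inner, banach}) TYPE('y::banach) \<and>
   complex_BPBpp TYPE('k::{complex_inner, banach}) TYPE('z::{complex_normed_vector, banach})"
proof
  interpret R: inner_product_operators "scaleR :: real \<Rightarrow> 'h \<Rightarrow> 'h" inner "\<lambda>r. r"
    "scaleR :: real \<Rightarrow> 'y \<Rightarrow> 'y"
    by unfold_locales
      (simp_all add: scaleR_add_right scaleR_add_left inner_commute inner_add_right
        power2_norm_eq_inner)
  have "R.ops = UNIV" by (simp add: R.ops_def blinfun.scaleR_right)
  then show "real_BPBpp TYPE('h) TYPE('y)"
    using R.BPBpp_on_ops by (simp add: real_BPBpp_def)
next
  interpret C: inner_product_operators "scaleC :: complex \<Rightarrow> 'k \<Rightarrow> 'k" cinner cnj
    "scaleC :: complex \<Rightarrow> 'z \<Rightarrow> 'z"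
  proof unfold_locales
    show "cinner x y = cnj (cinner y x)" for x y :: 'k by (rule cinner_commute)
    show "c *\<^sub>C (r *\<^sub>R y) = r *\<^sub>R (c *\<^sub>C y)" for c r and y :: 'z
      by (metis scaleC_of_real scaleC_scaleC mult.commute)
  qed (simp_all add: scaleC_add_right scaleC_add_left scaleC_scaleC scaleC_of_real norm_scaleC
      cinner_add_left cinner_scaleC_left cinner_self)
  have "C.ops = complex_blinfuns" by (simp add: C.ops_def complex_blinfuns_def)
  then show "complex_BPBpp TYPE('k) TYPE('z)"
    using C.BPBpp_on_ops by (simp add: complex_BPBpp_def)
qed

end
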